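(* Let $\nu$ be a positive integer and, for $k=1,\dots,\nu$, let $N_k=n_k+n_{k+1}+\dots+n_\nu$. Then for every non-negative integer $M$, \[ \sum_{n_1,\dots,n_\nu\geq 0} \frac{q^{3(N_1^2 + N_2^2+\dots + N_\nu^2)}(-q;q^2)_{3n_\nu}}{(q^6;q^6)_{M-N_1}(q^6;q^6)_{n_1}(q^6;q^6)_{n_2}\cdots (q^6;q^6)_{n_{\nu-1}}(q^6;q^6)_{2n_\nu}} = \frac{(-q^3;q^6)_M}{(q^6;q^6)_{2M}} \sum_{j=-M}^M q^{3(\nu+1)j^2 + 2j} {2M \brack M+j}_{q^6}. \]
   Context: For $n\ge 0$, $(a;q)_n=\prod_{k=0}^{n-1}(1-aq^k)$, and by convention $\frac{1}{(q;q)_n}=0$ for negative integers $n$ (so terms with $N_1>M$ vanish). For integers $A,B$, ${A\brack B}_x=\frac{(x;x)_A}{(x;x)_B(x;x)_{A-B}}$ if $B\ge 0$ and $A-B\ge 0$, and $0$ otherwise. *)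

theory Defs
  imports Complex_Main "HOL-Library.FuncSet"
begin

definition qpoch :: "'a::field \<Rightarrow> 'a \<Rightarrow> nat \<Rightarrow> 'a" where
  "qpoch a q n = (\<Prod>k<n. 1 - a * q ^ k)"

text \<open>\<open>rqfac x n\<close> is \<open>1 / (x; x)\<^sub>n\<close>, extended to all integers \<open>n\<close> by the
  convention that it is \<open>0\<close> for negative \<open>n\<close>.\<close>

definition rqfac :: "'a::field \<Rightarrow> int \<Rightarrow> 'a" where
  "rqfac x n = (if n < 0 then 0 else 1 / qpoch x x (nat n))"

definition qbinom :: "'a::field \<Rightarrow> int \<Rightarrow> int \<Rightarrow> 'a" where
  "qbinom x A B =
     (if B \<ge> 0 \<and> A - B \<ge> 0
      then qpoch x x (nat A) / (qpoch x x (nat B) * qpoch x x (nat (A - B)))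
      else 0)"

text \<open>\<open>tail_sum \<nu> n k\<close> is \<open>N\<^sub>k = n\<^sub>k + n\<^sub>k\<^sub>+\<^sub>1 + \<dots> + n\<^sub>\<nu>\<close>.\<close>

definition tail_sum :: "nat \<Rightarrow> (nat \<Rightarrow> nat) \<Rightarrow> nat \<Rightarrow> nat" where
  "tail_sum \<nu> n k = (\<Sum>i=k..\<nu>. n i)"

text \<open>A sum over all tuples \<open>(n\<^sub>1, \<dots>, n\<^sub>\<nu>)\<close> of natural numbers is written with the
  finite-support sum \<^const>\<open>sum'\<close> over \<open>{1..\<nu>} \<rightarrow>\<^sub>E UNIV\<close>. Since \<^const>\<open>sum'\<close>
  is \<open>0\<close> when the support is infinite, the following lemma is needed to know that the sum
  has its intended meaning when the summand contains the factor \<open>1 / (x; x)\<^sub>M\<^sub>-\<^sub>N\<close>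
  with \<open>N = N\<^sub>1\<close>.\<close>

lemma finite_support_rqfac:
  fixes x :: "'a::field"
  assumes "\<And>n. f n \<noteq> (0::'a) \<Longrightarrow> rqfac x (int M - int (tail_sum \<nu> n 1)) \<noteq> 0"
  shows "finite {n \<in> {1..\<nu>} \<rightarrow>\<^sub>E (UNIV :: nat set). f n \<noteq> 0}"
proof (rule finite_subset)
  show "finite ({1..\<nu>} \<rightarrow>\<^sub>E {..M})"
    by (intro finite_PiE) auto
  show "{n \<in> {1..\<nu>} \<rightarrow>\<^sub>E UNIV. f n \<noteq> 0} \<subseteq> {1..\<nu>} \<rightarrow>\<^sub>E {..M}"
  proof
    fix n assume n: "n \<in> {n \<in> {1..\<nu>} \<rightarrow>\<^sub>E UNIV. f n \<noteq> 0}"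
    then have "tail_sum \<nu> n 1 \<le> M"
      using assms[of n] by (auto simp: rqfac_def split: if_splits)
    moreover have "n i \<le> tail_sum \<nu> n 1" if "i \<in> {1..\<nu>}" for i
      unfolding tail_sum_def using that by (intro member_le_sum) auto
    ultimately show "n \<in> {1..\<nu>} \<rightarrow>\<^sub>E {..M}"
      using n by (force simp: PiE_iff)
  qed
qed

end

theory Submission
  imports Defs
begin

text \<open>The identity is an iterated Bailey lemma in base \<open>Q = q\<^sup>6\<close>. Let \<open>B\<^sub>m(M)\<close> be the right-hand
  side with \<open>\<nu>\<close> replaced by \<open>m\<close>. For \<open>m = 0\<close> the finite Jacobi triple product gives
  \<open>B\<^sub>0(M) = (-q; q\<^sup>2)\<^sub>3\<^sub>M / (Q; Q)\<^sub>2\<^sub>M\<close>. The q-Chu-Vandermonde sum, applied to each \<open>j\<close> separately,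
  gives \<open>B\<^sub>m\<^sub>+\<^sub>1(M) = \<Sum>\<^sub>N q^(3N\<^sup>2) B\<^sub>m(N) / (Q; Q)\<^sub>M\<^sub>-\<^sub>N\<close>. Unfolding this \<open>\<nu>\<close>
  times, with \<open>N = N\<^sub>1\<close> first, produces the multiple sum.\<close>

section \<open>q-Pochhammer symbols, q-binomial coefficients and the q-Pascal rule\<close>

lemma qpoch_0 [simp]: "qpoch a x 0 = 1"
  by (simp add: qpoch_def)

lemma qpoch_Suc: "qpoch a x (Suc n) = qpoch a x n * (1 - a * x ^ n)"
  by (simp add: qpoch_def)

lemma qpoch_add: "qpoch a x (m + n) = qpoch a x m * qpoch (a * x ^ m) x n"
  by (induction n) (simp_all add: qpoch_Suc power_add mult.assoc)

lemma qpoch_Suc_left: "qpoch a x (Suc n) = (1 - a) * qpoch (a * x) x n"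
  using qpoch_add[of a x 1 n] by (simp add: qpoch_def)

lemma qpoch_self_nonzero:
  fixes x :: "'a::field"
  assumes "\<forall>k>0. x ^ k \<noteq> 1"
  shows "qpoch x x n \<noteq> 0"
  using assms[rule_format, of "Suc _"] by (auto simp: qpoch_def)

lemma rqfac_of_nat [simp]: "rqfac x (int n) = 1 / qpoch x x n"
  by (simp add: rqfac_def)

lemma rqfac_neg: "k < 0 \<Longrightarrow> rqfac x k = 0"
  by (simp add: rqfac_def)

lemma qbinom_of_nat:
  "k \<le> n \<Longrightarrow> qbinom x (int n) (int k) = qpoch x x n / (qpoch x x k * qpoch x x (n - k))"
  by (simp add: qbinom_def nat_diff_distrib)

lemma qbinom_eq_rqfac:
  "A \<ge> 0 \<Longrightarrow> qbinom x A B = qpoch x x (nat A) * rqfac x B * rqfac x (A - B)"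
  by (simp add: qbinom_def rqfac_def)

text \<open>Of the two q-Pascal rules this is the one with the power on the lower neighbour. It
  comes from splitting the top factor \<open>1 - x ^ (n + 1)\<close> as
  \<open>(1 - x ^ (n - k)) + x ^ (n - k) * (1 - x ^ (k + 1))\<close>.\<close>

lemma qbinom_Suc_Suc:
  fixes x :: "'a::field"
  assumes "\<forall>k>0. x ^ k \<noteq> 1" and "k \<le> n"
  shows "qbinom x (int (Suc n)) (int (Suc k)) =
           qbinom x (int n) (int (Suc k)) + x ^ (n - k) * qbinom x (int n) (int k)"
proof (cases "k = n")
  case True
  have "qbinom x (int n) (int (Suc n)) = 0"
    by (simp add: qbinom_def)
  then show ?thesis
    using True qpoch_self_nonzero[OF assms(1)]
    by (simp add: qbinom_of_nat del: of_nat_Suc)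
next
  case False
  then obtain d where d: "n = Suc (k + d)"
    using assms(2) less_imp_Suc_add by (metis le_neq_implies_less)
  have nz: "qpoch x x i \<noteq> 0" for i
    by (rule qpoch_self_nonzero[OF assms(1)])
  have nz': "1 - x * x ^ i \<noteq> 0" for i
    using assms(1)[rule_format, of "Suc i"] by simp
  have b1: "qbinom x (int (Suc n)) (int (Suc k)) = qpoch x x (Suc n) / (qpoch x x (Suc k) * qpoch x x (Suc d))"
    using d by (subst qbinom_of_nat) auto
  have b2: "qbinom x (int n) (int (Suc k)) = qpoch x x n / (qpoch x x (Suc k) * qpoch x x d)"
    using d by (subst qbinom_of_nat) auto
  have b3: "qbinom x (int n) (int k) = qpoch x x n / (qpoch x x k * qpoch x x (Suc d))"
    using d by (subst qbinom_of_nat) auto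
  have split: "1 - x * x ^ n = (1 - x * x ^ d) + x ^ Suc d * (1 - x * x ^ k)"
    by (simp add: d algebra_simps power_add)
  have nk: "n - k = Suc d"
    using d by simp
  \<comment> \<open>The rule with opaque letters: \<open>U\<close> and \<open>V\<close> are the last
    factors of the symbols of length \<open>Suc k\<close> and \<open>Suc d\<close>, and
    \<open>w\<close> is \<open>x ^ Suc d\<close>.\<close>
  have "P * (V + w * U) / (K * U * (D * V)) = P / (K * U * D) + w * (P / (K * (D * V)))"
    if "K \<noteq> 0" "D \<noteq> 0" "U \<noteq> 0" "V \<noteq> 0" for P K D U V w :: 'a
    using that by (simp add: divide_simps) (simp add: algebra_simps)
  then show ?thesis
    unfolding b1 b2 b3 nk qpoch_Suc split using nz nz' by blast
qed

lemma sum_qbinom_Suc: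
  fixes x :: "'a::field"
  assumes "\<forall>k>0. x ^ k \<noteq> 1"
  shows "(\<Sum>k\<le>Suc n. qbinom x (int (Suc n)) (int k) * f k) =
           (\<Sum>k\<le>n. qbinom x (int n) (int k) * f k)
           + (\<Sum>k\<le>n. x ^ (n - k) * qbinom x (int n) (int k) * f (Suc k))"
proof -
  have b0: "qbinom x (int m) (int 0) = 1" for m
    using qpoch_self_nonzero[OF assms] by (simp add: qbinom_of_nat del: of_nat_0)
  have "(\<Sum>k\<le>Suc n. qbinom x (int (Suc n)) (int k) * f k) =
      f 0 + (\<Sum>k\<le>n. qbinom x (int n) (int (Suc k)) * f (Suc k)
        + x ^ (n - k) * qbinom x (int n) (int k) * f (Suc k))"
    by (subst sum.atMost_Suc_shift)
       (simp add: b0 qbinom_Suc_Suc[OF assms] distrib_right del: of_nat_Suc of_nat_0)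
  also have "\<dots> = (f 0 + (\<Sum>k\<le>n. qbinom x (int n) (int (Suc k)) * f (Suc k)))
        + (\<Sum>k\<le>n. x ^ (n - k) * qbinom x (int n) (int k) * f (Suc k))"
    by (simp only: sum.distrib add.assoc)
  also have "f 0 + (\<Sum>k\<le>n. qbinom x (int n) (int (Suc k)) * f (Suc k)) =
      (\<Sum>k\<le>Suc n. qbinom x (int n) (int k) * f k)"
    by (subst sum.atMost_Suc_shift) (simp add: b0 del: of_nat_Suc of_nat_0)
  also have "\<dots> = (\<Sum>k\<le>n. qbinom x (int n) (int k) * f k)"
    by (simp add: qbinom_def)
  finally show ?thesis .
qed

section \<open>The q-Chu-Vandermonde sum\<close>

lemma choose_two_Suc: "Suc k choose 2 = k + (k choose 2)"
  by (simp add: numeral_2_eq_2)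

lemma double_choose_two: "2 * (k choose 2) + k = k\<^sup>2"
  by (induction k) (simp_all add: binomial_eq_0 choose_two_Suc power2_eq_square)

text \<open>The usual quotients of \<open>qpoch b x k\<close> by \<open>qpoch (b * d) x k\<close>
  are cleared by multiplying with \<open>qpoch (b * d) x n\<close>, so zeros of that symbol do no
  harm; \<open>b = 0\<close> gives the q-binomial theorem. In the induction the q-Pascal rule yields
  two sums, at \<open>b\<close> and at \<open>b * x\<close>, and
  \<open>(1 - b * d * x ^ n) - d * x ^ n * (1 - b) = 1 - d * x ^ n\<close>.\<close>

lemma q_chu_vandermonde:
  fixes x :: "'a::field"
  assumes "\<forall>k>0. x ^ k \<noteq> 1"
  shows "(\<Sum>k\<le>n. qbinom x (int n) (int k) * ((- d) ^ k * x ^ (k choose 2) * qpoch b x k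
             * qpoch (b * d * x ^ k) x (n - k))) = qpoch d x n"
proof (induction n arbitrary: b)
  case 0
  then show ?case
    by (simp add: qbinom_def numeral_2_eq_2)
next
  case (Suc n)
  have "(\<Sum>k\<le>n. qbinom x (int n) (int k) * ((- d) ^ k * x ^ (k choose 2) * qpoch b x k
             * qpoch (b * d * x ^ k) x (Suc n - k)))
      = (\<Sum>k\<le>n. (1 - b * d * x ^ n) * (qbinom x (int n) (int k) * ((- d) ^ k * x ^ (k choose 2) * qpoch b x k
             * qpoch (b * d * x ^ k) x (n - k))))"
  proof (rule sum.cong)
    fix k assume "k \<in> {..n}"
    \<comment> \<open>The last factor does not depend on \<open>k\<close>, since
      \<open>x ^ k * x ^ (n - k) = x ^ n\<close>; it can leave the sum.\<close>
    then have "qpoch (b * d * x ^ k) x (Suc n - k) = qpoch (b * d * x ^ k) x (n - k) * (1 - b * d * x ^ n)"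
      by (simp add: Suc_diff_le qpoch_Suc mult.assoc flip: power_add)
    then show "qbinom x (int n) (int k) * ((- d) ^ k * x ^ (k choose 2) * qpoch b x k
             * qpoch (b * d * x ^ k) x (Suc n - k)) = (1 - b * d * x ^ n) * (qbinom x (int n) (int k) * ((- d) ^ k * x ^ (k choose 2) * qpoch b x k
             * qpoch (b * d * x ^ k) x (n - k)))"
      by (simp add: mult_ac)
  qed simp
  also have "\<dots> = (1 - b * d * x ^ n) * qpoch d x n"
    by (simp only: Suc.IH flip: sum_distrib_left)
  finally have s1: "(\<Sum>k\<le>n. qbinom x (int n) (int k) * ((- d) ^ k * x ^ (k choose 2) * qpoch b x k
             * qpoch (b * d * x ^ k) x (Suc n - k))) = (1 - b * d * x ^ n) * qpoch d x n" .
  have "(\<Sum>k\<le>n. x ^ (n - k) * qbinom x (int n) (int k) * ((- d) ^ Suc k * x ^ (Suc k choose 2)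
             * qpoch b x (Suc k) * qpoch (b * d * x ^ Suc k) x (Suc n - Suc k)))
      = (\<Sum>k\<le>n. - (d * x ^ n * (1 - b)) * (qbinom x (int n) (int k) * ((- d) ^ k * x ^ (k choose 2)
             * qpoch (b * x) x k * qpoch ((b * x) * d * x ^ k) x (n - k))))"
  proof (rule sum.cong)
    fix k assume "k \<in> {..n}"
    \<comment> \<open>The q-Pascal weight \<open>x ^ (n - k)\<close> meets the \<open>x ^ k\<close>
      from \<open>Suc k choose 2\<close>, again giving a factor free of \<open>k\<close>. Splitting
      \<open>1 - b\<close> off the front of \<open>qpoch b x (Suc k)\<close> moves \<open>b\<close>
      to \<open>b * x\<close>.\<close>
    then have xn: "x ^ n = x ^ (n - k) * x ^ k"
      by (simp flip: power_add)
    have arg: "b * d * x ^ Suc k = (b * x) * d * x ^ k"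
      by simp
    show "x ^ (n - k) * qbinom x (int n) (int k) * ((- d) ^ Suc k * x ^ (Suc k choose 2)
             * qpoch b x (Suc k) * qpoch (b * d * x ^ Suc k) x (Suc n - Suc k))
        = - (d * x ^ n * (1 - b)) * (qbinom x (int n) (int k) * ((- d) ^ k * x ^ (k choose 2)
             * qpoch (b * x) x k * qpoch ((b * x) * d * x ^ k) x (n - k)))"
      unfolding arg xn qpoch_Suc_left choose_two_Suc power_add diff_Suc_Suc power_Suc[of "- d"]
      by (simp only: mult_ac mult_minus_left mult_minus_right)
  qed simp
  also have "\<dots> = - (d * x ^ n * (1 - b)) * qpoch d x n"
    by (simp only: Suc.IH flip: sum_distrib_left)
  finally show ?case
    unfolding sum_qbinom_Suc[OF assms] s1 by (simp add: qpoch_Suc algebra_simps)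
qed

section \<open>The Bailey kernel: summation over N for fixed j\<close>

text \<open>With \<open>N = j + k\<close>, this is the q-Chu-Vandermonde sum in base \<open>p\<^sup>2\<close> at \<open>b = d = - p ^ (2 * j + 1)\<close>.\<close>

lemma bailey_kernel_nat:
  fixes p :: "'a::field"
  assumes "\<forall>k>0. p ^ k \<noteq> 1" and "j \<le> M"
  shows "(\<Sum>N\<le>M. p ^ N\<^sup>2 * rqfac (p\<^sup>2) (int M - int N) * qpoch (- p) (p\<^sup>2) N
             * (rqfac (p\<^sup>2) (int N - int j) * rqfac (p\<^sup>2) (int N + int j)))
       = qpoch (- p) (p\<^sup>2) M * p ^ j\<^sup>2 * (rqfac (p\<^sup>2) (int M - int j) * rqfac (p\<^sup>2) (int M + int j))"
proof -
  define x where "x = p\<^sup>2"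
  have x: "\<forall>k>0. x ^ k \<noteq> 1"
    using assms(1) by (simp add: x_def flip: power_mult)
  note nz = qpoch_self_nonzero[OF x]
  define m where "m = M - j"
  have M: "M = j + m"
    using assms(2) by (simp add: m_def)
  \<comment> \<open>The symbol in base \<open>- p\<close> continues with \<open>d\<close> after
    \<open>j\<close> factors; as \<open>d * d = x ^ (2 * j + 1)\<close>, the same \<open>d\<close>
    also continues \<open>qpoch x x (2 * j)\<close>.\<close>
  define d where "d = - p * x ^ j"
  define C where "C = p ^ j\<^sup>2 * qpoch (- p) x j / (qpoch x x m * qpoch x x (m + 2 * j))"
  have "(\<Sum>N\<le>M. p ^ N\<^sup>2 * rqfac x (int M - int N) * qpoch (- p) x N
             * (rqfac x (int N - int j) * rqfac x (int N + int j)))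
      = (\<Sum>N\<in>{j..M}. p ^ N\<^sup>2 * rqfac x (int M - int N) * qpoch (- p) x N
             * (rqfac x (int N - int j) * rqfac x (int N + int j)))"
    by (rule sum.mono_neutral_right) (auto simp: rqfac_neg)
  also have "\<dots> = (\<Sum>k\<le>m. p ^ (j + k)\<^sup>2 * rqfac x (int M - int (j + k)) * qpoch (- p) x (j + k)
             * (rqfac x (int (j + k) - int j) * rqfac x (int (j + k) + int j)))"
    by (rule sum.reindex_bij_witness[of _ "\<lambda>k. j + k" "\<lambda>N. N - j"]) (auto simp: M)
  also have "\<dots> = (\<Sum>k\<le>m. C * (qbinom x (int m) (int k) * ((- d) ^ k * x ^ (k choose 2) * qpoch d x k
             * qpoch (d * d * x ^ k) x (m - k))))"
  proof (rule sum.cong)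
    fix k assume "k \<in> {..m}"
    then have k: "k \<le> m" by simp
    \<comment> \<open>The three summands become the constant \<open>p ^ j\<^sup>2\<close>, the power
      \<open>(- d) ^ k\<close> and the triangular power of \<open>x\<close>.\<close>
    have "(j + k)\<^sup>2 = j\<^sup>2 + (1 + 2 * j) * k + 2 * (k choose 2)"
      using double_choose_two[of k] by (simp add: power2_sum algebra_simps)
    then have "p ^ (j + k)\<^sup>2 = p ^ j\<^sup>2 * p ^ ((1 + 2 * j) * k) * p ^ (2 * (k choose 2))"
      by (simp only: power_add)
    also have "p ^ ((1 + 2 * j) * k) = (- d) ^ k"
      by (simp add: d_def x_def power_mult flip: power_mult power_Suc)
    finally have pw: "p ^ (j + k)\<^sup>2 = p ^ j\<^sup>2 * (- d) ^ k * x ^ (k choose 2)"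
      by (simp only: x_def power_mult)
    have "d * d = x * (x ^ j * x ^ j)"
      by (simp add: d_def x_def power2_eq_square mult_ac)
    moreover have "x ^ (2 * j) = x ^ j * x ^ j"
      unfolding mult_2 by (rule power_add)
    ultimately have "d * d * x ^ k = x * x ^ (k + 2 * j)"
      by (simp only: power_add mult_ac)
    \<comment> \<open>The reciprocal of \<open>qpoch x x (k + 2 * j)\<close> is extended to the
      common denominator \<open>qpoch x x (m + 2 * j)\<close>, which is part of
      \<open>C\<close>.\<close>
    then have top: "qpoch x x (m + 2 * j) = qpoch x x (k + 2 * j) * qpoch (d * d * x ^ k) x (m - k)"
      using qpoch_add[of x x "k + 2 * j" "m - k"] k by (simp add: add.commute)
    have "qpoch (d * d * x ^ k) x (m - k) \<noteq> 0"
      using nz[of "m + 2 * j"] unfolding top by simp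
    then have tail: "qpoch (d * d * x ^ k) x (m - k) / qpoch x x (m + 2 * j) = 1 / qpoch x x (k + 2 * j)"
      unfolding top by simp
    have "int M - int (j + k) = int (m - k)" "int (j + k) - int j = int k" "int (j + k) + int j = int (k + 2 * j)"
      using k by (simp_all add: M of_nat_diff)
    then have r: "rqfac x (int M - int (j + k)) = 1 / qpoch x x (m - k)"
      "rqfac x (int (j + k) - int j) = 1 / qpoch x x k"
      "rqfac x (int (j + k) + int j) = 1 / qpoch x x (k + 2 * j)"
      by (simp_all only: rqfac_of_nat)
    have "p ^ (j + k)\<^sup>2 * rqfac x (int M - int (j + k)) * qpoch (- p) x (j + k)
             * (rqfac x (int (j + k) - int j) * rqfac x (int (j + k) + int j))
       = p ^ j\<^sup>2 * (- d) ^ k * x ^ (k choose 2) * (1 / qpoch x x (m - k)) * (qpoch (- p) x j * qpoch d x k)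
          * (1 / qpoch x x k * (qpoch (d * d * x ^ k) x (m - k) / qpoch x x (m + 2 * j)))"
      unfolding tail r pw by (simp add: qpoch_add d_def)
    also have "\<dots> = C * (qbinom x (int m) (int k) * ((- d) ^ k * x ^ (k choose 2) * qpoch d x k
             * qpoch (d * d * x ^ k) x (m - k)))"
      using nz[of m] by (simp add: C_def qbinom_of_nat[OF k] mult_ac)
    finally show "p ^ (j + k)\<^sup>2 * rqfac x (int M - int (j + k)) * qpoch (- p) x (j + k)
             * (rqfac x (int (j + k) - int j) * rqfac x (int (j + k) + int j))
        = C * (qbinom x (int m) (int k) * ((- d) ^ k * x ^ (k choose 2) * qpoch d x k
             * qpoch (d * d * x ^ k) x (m - k)))" .
  qed simp
  also have "\<dots> = C * qpoch d x m"
    by (simp only: q_chu_vandermonde[OF x] flip: sum_distrib_left)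
  also have "\<dots> = qpoch (- p) x M * p ^ j\<^sup>2 * (rqfac x (int M - int j) * rqfac x (int M + int j))"
  proof -
    have "int M - int j = int m" "int M + int j = int (m + 2 * j)"
      by (simp_all add: M)
    then show ?thesis
      by (simp only: rqfac_of_nat) (simp add: C_def M qpoch_add d_def)
  qed
  finally show ?thesis
    by (simp only: x_def)
qed

text \<open>Both sides are invariant under \<open>j\<close> to \<open>- j\<close>, so the case of
  natural \<open>j\<close> suffices.\<close>

lemma bailey_kernel:
  fixes p :: "'a::field" and j :: int
  assumes "\<forall>k>0. p ^ k \<noteq> 1" and "\<bar>j\<bar> \<le> int M"
  shows "(\<Sum>N\<le>M. p ^ N\<^sup>2 * rqfac (p\<^sup>2) (int M - int N) * qpoch (- p) (p\<^sup>2) N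
             * (rqfac (p\<^sup>2) (int N - j) * rqfac (p\<^sup>2) (int N + j)))
       = qpoch (- p) (p\<^sup>2) M * p ^ nat (j\<^sup>2) * (rqfac (p\<^sup>2) (int M - j) * rqfac (p\<^sup>2) (int M + j))"
proof -
  have sym: "rqfac (p\<^sup>2) (int N - j) * rqfac (p\<^sup>2) (int N + j)
      = rqfac (p\<^sup>2) (int N - int (nat \<bar>j\<bar>)) * rqfac (p\<^sup>2) (int N + int (nat \<bar>j\<bar>))" for N
    by (cases "j \<ge> 0") (simp_all add: mult.commute)
  have "nat (j\<^sup>2) = (nat \<bar>j\<bar>)\<^sup>2"
    by (simp flip: nat_power_eq)
  then show ?thesis
    unfolding sym using bailey_kernel_nat[OF assms(1), where j = "nat \<bar>j\<bar>" and M = M] assms(2) by simp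
qed

section \<open>The Bailey iteration on the right-hand sides\<close>

text \<open>The factor \<open>1 / (Q; Q)\<^sub>2\<^sub>M\<close> is absorbed into the q-binomial coefficients.\<close>

definition bailey_sum :: "'a::field \<Rightarrow> nat \<Rightarrow> nat \<Rightarrow> 'a" where
  "bailey_sum q m M = qpoch (- (q ^ 3)) (q ^ 6) M *
     (\<Sum>j = - int M..int M. q powi (3 * (int m + 1) * j\<^sup>2 + 2 * j)
        * (rqfac (q ^ 6) (int M - j) * rqfac (q ^ 6) (int M + j)))"

lemma bailey_sum_eq_qbinom:
  fixes q :: "'a::field"
  assumes "\<forall>k>0. q ^ k \<noteq> 1"
  shows "bailey_sum q m M = qpoch (- (q ^ 3)) (q ^ 6) M / qpoch (q ^ 6) (q ^ 6) (2 * M)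
           * (\<Sum>j = - int M..int M. q powi (3 * (int m + 1) * j\<^sup>2 + 2 * j)
                * qbinom (q ^ 6) (2 * int M) (int M + j))"
proof -
  have x: "\<forall>k>0. (q ^ 6) ^ k \<noteq> 1"
    using assms by (simp flip: power_mult)
  have "nat (2 * int M) = 2 * M"
    by simp
  then have "qbinom (q ^ 6) (2 * int M) (int M + j)
      = qpoch (q ^ 6) (q ^ 6) (2 * M) * (rqfac (q ^ 6) (int M - j) * rqfac (q ^ 6) (int M + j))" for j
    by (simp add: qbinom_eq_rqfac mult_ac)
  then show ?thesis
    unfolding bailey_sum_def
    using qpoch_self_nonzero[OF x, of "2 * M"]
    by (simp add: sum_distrib_left mult_ac)
qed

text \<open>After exchanging the sums, the kernel at \<open>p = q ^ 3\<close> gives each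
  \<open>j\<close> an extra \<open>q ^ (3 * j\<^sup>2)\<close>, which raises the quadratic
  coefficient from \<open>3 * (m + 1)\<close> to \<open>3 * (m + 2)\<close>.\<close>

lemma bailey_sum_Suc:
  fixes q :: "'a::field"
  assumes "\<forall>k>0. q ^ k \<noteq> 1"
  shows "bailey_sum q (Suc m) M
       = (\<Sum>N\<le>M. q ^ (3 * N\<^sup>2) * rqfac (q ^ 6) (int M - int N) * bailey_sum q m N)"
proof -
  define p where "p = q ^ 3"
  have p: "\<forall>k>0. p ^ k \<noteq> 1"
    using assms by (simp add: p_def flip: power_mult)
  have p2: "q ^ 6 = p\<^sup>2"
    by (simp add: p_def flip: power_mult)
  define e where "e j = q powi (3 * (int m + 1) * j\<^sup>2 + 2 * j)" for j
  define R where "R N j = rqfac (p\<^sup>2) (int N - j) * rqfac (p\<^sup>2) (int N + j)" for N j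
  \<comment> \<open>The case \<open>q = 0\<close> is included, so adding exponents requires a
    nonzero total exponent; for \<open>j \<noteq> 0\<close> it is positive, and \<open>j = 0\<close>
    is trivial.\<close>
  have e: "q powi (3 * (int (Suc m) + 1) * j\<^sup>2 + 2 * j) = p ^ nat (j\<^sup>2) * e j" for j
  proof (cases "j = 0")
    case False
    have "0 \<le> (j + 1)\<^sup>2"
      by simp
    then have "0 \<le> j\<^sup>2 + 2 * j + 1"
      by (simp add: power2_sum)
    moreover have "1 \<le> j\<^sup>2"
      using False by (simp add: int_one_le_iff_zero_less)
    moreover have "0 \<le> int m * j\<^sup>2"
      by simp
    ultimately have "0 < 6 * j\<^sup>2 + 3 * (int m * j\<^sup>2) + 2 * j"
      by linarith
    then have "3 * j\<^sup>2 + (3 * (int m + 1) * j\<^sup>2 + 2 * j) \<noteq> 0"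
      by (simp add: algebra_simps)
    then have "q powi (3 * j\<^sup>2 + (3 * (int m + 1) * j\<^sup>2 + 2 * j)) = q powi (3 * j\<^sup>2) * e j"
      unfolding e_def by (subst power_int_add) auto
    moreover have "q powi (3 * j\<^sup>2) = p ^ nat (j\<^sup>2)"
      by (simp add: p_def power_int_def nat_mult_distrib power_mult)
    ultimately show ?thesis
      by (simp add: algebra_simps)
  qed (simp add: e_def)
  have "(\<Sum>N\<le>M. q ^ (3 * N\<^sup>2) * rqfac (q ^ 6) (int M - int N) * bailey_sum q m N)
      = (\<Sum>N\<le>M. \<Sum>j = - int M..int M. e j *
          (p ^ N\<^sup>2 * rqfac (p\<^sup>2) (int M - int N) * qpoch (- p) (p\<^sup>2) N * R N j))"
  proof (rule sum.cong)
    fix N assume "N \<in> {..M}"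
    \<comment> \<open>\<open>R N j\<close> vanishes for \<open>\<bar>j\<bar> > N\<close>; widening
      the range to \<open>M\<close> makes it independent of \<open>N\<close>, so that the sums can
      be exchanged.\<close>
    then have "(\<Sum>j = - int N..int N. e j * R N j) = (\<Sum>j = - int M..int M. e j * R N j)"
      by (intro sum.mono_neutral_left) (auto simp: R_def rqfac_def)
    then show "q ^ (3 * N\<^sup>2) * rqfac (q ^ 6) (int M - int N) * bailey_sum q m N
        = (\<Sum>j = - int M..int M. e j * (p ^ N\<^sup>2 * rqfac (p\<^sup>2) (int M - int N) * qpoch (- p) (p\<^sup>2) N * R N j))"
      unfolding bailey_sum_def p2 e_def[symmetric] R_def[symmetric]
      by (simp add: sum_distrib_left mult_ac power_mult flip: p_def)
  qed simp
  also have "\<dots> = (\<Sum>j = - int M..int M. e j *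
      (\<Sum>N\<le>M. p ^ N\<^sup>2 * rqfac (p\<^sup>2) (int M - int N) * qpoch (- p) (p\<^sup>2) N * R N j))"
    by (subst sum.swap) (simp only: sum_distrib_left)
  also have "\<dots> = (\<Sum>j = - int M..int M. e j * (qpoch (- p) (p\<^sup>2) M * p ^ nat (j\<^sup>2) * R M j))"
    unfolding R_def by (intro sum.cong refl arg_cong2[where f = "(*)"] bailey_kernel p) auto
  also have "\<dots> = bailey_sum q (Suc m) M"
    unfolding bailey_sum_def p2 e R_def[symmetric] by (simp add: sum_distrib_left mult_ac flip: p_def)
  finally show ?thesis ..
qed

section \<open>The starting value: finite Jacobi triple product\<close>

text \<open>The odd exponents below \<open>6 * n\<close> are sorted by their residues 1, 3, 5 modulo
  6.\<close>

lemma qpoch_cubed_base: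
  fixes q :: "'a::field"
  shows "qpoch (- q) (q\<^sup>2) (3 * n)
    = qpoch (- q) (q ^ 6) n * qpoch (- (q ^ 3)) (q ^ 6) n * qpoch (- (q ^ 5)) (q ^ 6) n"
proof (induction n)
  case (Suc n)
  have "(q\<^sup>2) ^ (3 * n) = (q ^ 6) ^ n"
    by (simp flip: power_mult)
  moreover have "q * (q\<^sup>2 * w) = q ^ 3 * w" "q * (q\<^sup>2 * (q\<^sup>2 * w)) = q ^ 5 * w" for w
    by (simp_all add: eval_nat_numeral mult_ac)
  moreover have "3 * Suc n = Suc (Suc (Suc (3 * n)))"
    by simp
  ultimately have step: "qpoch (- q) (q\<^sup>2) (3 * Suc n) = qpoch (- q) (q\<^sup>2) (3 * n) *
      ((1 + q * (q ^ 6) ^ n) * (1 + q ^ 3 * (q ^ 6) ^ n) * (1 + q ^ 5 * (q ^ 6) ^ n))"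
    by (simp only: qpoch_Suc power_Suc minus_mult_left[symmetric] diff_minus_eq_add mult.assoc)
  show ?case
    unfolding step Suc.IH qpoch_Suc by (simp add: mult_ac)
qed simp

text \<open>The factors are \<open>1 + q powi (5 - 6 * i)\<close> for \<open>i = 1, ..., n\<close>.
  Extracting the negative power turns each into \<open>1 + q ^ (6 * i - 5)\<close>, and the
  exponents \<open>6 * i - 5\<close> add up to \<open>3 * n\<^sup>2 - 2 * n\<close>.\<close>

lemma qpoch_shift_neg:
  fixes q :: "'a::field"
  assumes "q \<noteq> 0"
  shows "q ^ (3 * n\<^sup>2) * qpoch (- (q ^ 5 / (q ^ 6) ^ n)) (q ^ 6) n = q ^ (2 * n) * qpoch (- q) (q ^ 6) n"
proof (induction n)
  case (Suc n)
  have cancel: "- (u / (w * v)) * w = - (u / v)" if "w \<noteq> 0" for u v w :: 'a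
    using that by simp
  have arg: "- (q ^ 5 / (q ^ 6) ^ Suc n) * q ^ 6 = - (q ^ 5 / (q ^ 6) ^ n)"
    unfolding power_Suc by (rule cancel) (simp add: assms)
  have fac: "q ^ (6 * n + 3) * (1 + q ^ 5 / (q ^ 6) ^ Suc n) = q ^ 2 * (1 + q * (q ^ 6) ^ n)"
    using assms by (simp add: field_simps flip: power_mult power_add power_Suc)
  have "3 * (Suc n)\<^sup>2 = 3 * n\<^sup>2 + (6 * n + 3)"
    by (simp add: power2_eq_square)
  then have "q ^ (3 * (Suc n)\<^sup>2) * qpoch (- (q ^ 5 / (q ^ 6) ^ Suc n)) (q ^ 6) (Suc n)
      = (q ^ (6 * n + 3) * (1 + q ^ 5 / (q ^ 6) ^ Suc n)) *
        (q ^ (3 * n\<^sup>2) * qpoch (- (q ^ 5 / (q ^ 6) ^ n)) (q ^ 6) n)"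
    unfolding qpoch_Suc_left arg by (simp add: power_add)
  also have "\<dots> = q ^ (2 * Suc n) * qpoch (- q) (q ^ 6) (Suc n)"
    unfolding fac Suc.IH by (simp add: qpoch_Suc power_add power2_eq_square)
  finally show ?case .
qed simp

text \<open>With \<open>k = n + j\<close> this is the q-binomial theorem for
  \<open>qpoch (- z) x (2 * n)\<close>. Its first \<open>n\<close> factors carry negative exponents
  and are inverted by \<open>qpoch_shift_neg\<close>; the other \<open>n\<close> start at
  \<open>q ^ 5\<close>.\<close>

lemma finite_jacobi_triple:
  fixes q :: "'a::field"
  assumes "\<forall>k>0. q ^ k \<noteq> 1" and "q \<noteq> 0"
  shows "(\<Sum>j = - int n..int n. q powi (3 * j\<^sup>2 + 2 * j) * qbinom (q ^ 6) (2 * int n) (int n + j))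
       = qpoch (- q) (q ^ 6) n * qpoch (- (q ^ 5)) (q ^ 6) n"
proof -
  define x where "x = q ^ 6"
  have x: "\<forall>k>0. x ^ k \<noteq> 1"
    using assms(1) by (simp add: x_def flip: power_mult)
  have [simp]: "qpoch 0 x k = 1" for k
    by (simp add: qpoch_def)
  \<comment> \<open>Chosen to complete the square: \<open>(5 - 6 * n) * k + 6 * (k choose 2) + 3 *
    n\<^sup>2 = 3 * (k - n)\<^sup>2 + 2 * k\<close>.\<close>
  define z where "z = q ^ 5 / x ^ n"
  have z: "z = q powi (5 - 6 * int n)"
    using assms(2) power_int_of_nat[of q "6 * n"]
    by (simp add: z_def x_def power_int_diff flip: power_mult)
  have pw: "q ^ (3 * n\<^sup>2) * (z ^ k * x ^ (k choose 2))
      = q ^ (2 * n) * q powi (3 * (int k - int n)\<^sup>2 + 2 * (int k - int n))" for k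
  proof -
    have c: "2 * int (k choose 2) + int k = (int k)\<^sup>2"
      using double_choose_two[of k] by (metis of_nat_add of_nat_mult of_nat_numeral of_nat_power)
    have "q ^ (3 * n\<^sup>2) * (z ^ k * x ^ (k choose 2))
        = q powi int (3 * n\<^sup>2) * (q powi ((5 - 6 * int n) * int k) * q powi int (6 * (k choose 2)))"
      unfolding z x_def power_int_mult power_int_of_nat power_mult by simp
    also have "\<dots> = q powi (int (3 * n\<^sup>2) + ((5 - 6 * int n) * int k + int (6 * (k choose 2))))"
      using assms(2) by (simp only: power_int_add simp_thms)
    also have "int (3 * n\<^sup>2) + ((5 - 6 * int n) * int k + int (6 * (k choose 2)))
        = int (2 * n) + (3 * (int k - int n)\<^sup>2 + 2 * (int k - int n))"
      using c by (simp add: power2_eq_square algebra_simps)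
    also have "q powi \<dots> = q ^ (2 * n) * q powi (3 * (int k - int n)\<^sup>2 + 2 * (int k - int n))"
      using assms(2) by (simp only: power_int_add simp_thms power_int_of_nat)
    finally show ?thesis .
  qed
  have "(\<Sum>j = - int n..int n. q powi (3 * j\<^sup>2 + 2 * j) * qbinom x (2 * int n) (int n + j))
      = (\<Sum>k\<le>2 * n. q powi (3 * (int k - int n)\<^sup>2 + 2 * (int k - int n)) * qbinom x (int (2 * n)) (int k))"
    by (rule sum.reindex_bij_witness[of _ "\<lambda>k. int k - int n" "\<lambda>j. nat (int n + j)"]) auto
  then have "q ^ (2 * n) * (\<Sum>j = - int n..int n. q powi (3 * j\<^sup>2 + 2 * j) * qbinom x (2 * int n) (int n + j))
      = (\<Sum>k\<le>2 * n. q ^ (2 * n) * q powi (3 * (int k - int n)\<^sup>2 + 2 * (int k - int n)) * qbinom x (int (2 * n)) (int k))"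
    by (simp only: sum_distrib_left mult.assoc)
  also have "\<dots> = q ^ (3 * n\<^sup>2) * (\<Sum>k\<le>2 * n. qbinom x (int (2 * n)) (int k) * (z ^ k * x ^ (k choose 2)))"
    unfolding pw[symmetric] by (simp only: sum_distrib_left mult_ac)
  also have "(\<Sum>k\<le>2 * n. qbinom x (int (2 * n)) (int k) * (z ^ k * x ^ (k choose 2))) = qpoch (- z) x (2 * n)"
    using q_chu_vandermonde[OF x, where b = 0 and d = "- z" and n = "2 * n"] by simp
  also have "\<dots> = qpoch (- z) x n * qpoch (- (q ^ 5)) x n"
    using assms(2) by (simp add: mult_2 qpoch_add z_def x_def)
  also have "q ^ (3 * n\<^sup>2) * \<dots> = q ^ (2 * n) * (qpoch (- q) x n * qpoch (- (q ^ 5)) x n)"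
    using qpoch_shift_neg[OF assms(2), of n] by (simp add: z_def x_def)
  finally show ?thesis
    using assms(2) by (simp add: x_def)
qed

text \<open>The triple product supplies the residues 1 and 5 modulo 6, and the prefactor of
  \<open>bailey_sum\<close> the residue 3.\<close>

lemma bailey_sum_0:
  fixes q :: "'a::field"
  assumes "\<forall>k>0. q ^ k \<noteq> 1"
  shows "bailey_sum q 0 M = qpoch (- q) (q\<^sup>2) (3 * M) / qpoch (q ^ 6) (q ^ 6) (2 * M)"
proof (cases "q = 0")
  case True
  \<comment> \<open>Division by powers of \<open>q\<close> excludes \<open>q = 0\<close> above. Here
    only the term with exponent zero survives, namely \<open>j = 0\<close>, because
    \<open>3 * j + 2\<close> has no integer root.\<close>
  have "3 * j\<^sup>2 + 2 * j \<noteq> 0" if "j \<noteq> 0" for j :: int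
  proof
    assume "3 * j\<^sup>2 + 2 * j = 0"
    then have "j * (3 * j + 2) = 0"
      by (simp add: power2_eq_square algebra_simps)
    with that show False
      by simp
  qed
  then have "(\<Sum>j = - int M..int M. q powi (3 * j\<^sup>2 + 2 * j) * qbinom (q ^ 6) (2 * int M) (int M + j))
      = (\<Sum>j\<in>{0}. q powi (3 * j\<^sup>2 + 2 * j) * qbinom (q ^ 6) (2 * int M) (int M + j))"
    using True by (intro sum.mono_neutral_right) (auto simp: power_int_0_left_if)
  also have "\<dots> = 1"
    using True by (simp add: qpoch_def qbinom_def)
  finally have "bailey_sum q 0 M = qpoch (- (q ^ 3)) (q ^ 6) M / qpoch (q ^ 6) (q ^ 6) (2 * M)"
    by (simp add: bailey_sum_eq_qbinom[OF assms])
  then show ?thesis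
    using True by (simp add: qpoch_def)
next
  case False
  then show ?thesis
    by (simp add: bailey_sum_eq_qbinom[OF assms] finite_jacobi_triple[OF assms] qpoch_cubed_base)
qed

section \<open>Unfolding the multiple sum\<close>

lemma tail_sum_rec: "a \<le> \<nu> \<Longrightarrow> tail_sum \<nu> n a = n a + tail_sum \<nu> n (Suc a)"
  by (simp add: tail_sum_def sum.atLeast_Suc_atMost)

lemma tail_sum_upd: "a < k \<Longrightarrow> tail_sum \<nu> (n(a := y)) k = tail_sum \<nu> n k"
  by (auto simp: tail_sum_def intro!: sum.cong)

text \<open>Downward induction on \<open>a\<close>: separating the variable \<open>n a\<close> and
  summing over \<open>N = tail_sum \<nu> n a\<close> is one Bailey step. The box bound
  \<open>L\<close> stays fixed while \<open>M\<close> varies, since the inner sum is needed at every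
  \<open>N \<le> M\<close>.\<close>

lemma bailey_multisum:
  fixes q :: "'a::field"
  assumes q: "\<forall>k>0. q ^ k \<noteq> 1"
    and "a \<le> \<nu>" and "M \<le> L"
  shows "(\<Sum>n\<in>{a..\<nu>} \<rightarrow>\<^sub>E {..L}. q ^ (3 * (\<Sum>k=a..\<nu>. (tail_sum \<nu> n k)\<^sup>2)) * qpoch (- q) (q\<^sup>2) (3 * n \<nu>)
             * rqfac (q ^ 6) (int M - int (tail_sum \<nu> n a))
             / ((\<Prod>k=a..<\<nu>. qpoch (q ^ 6) (q ^ 6) (n k)) * qpoch (q ^ 6) (q ^ 6) (2 * n \<nu>)))
       = bailey_sum q (Suc (\<nu> - a)) M"
  using assms(2,3)
proof (induction a arbitrary: M rule: inc_induct)
  case base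
  have "(\<Sum>n\<in>{\<nu>..\<nu>} \<rightarrow>\<^sub>E {..L}. q ^ (3 * (\<Sum>k=\<nu>..\<nu>. (tail_sum \<nu> n k)\<^sup>2)) * qpoch (- q) (q\<^sup>2) (3 * n \<nu>)
             * rqfac (q ^ 6) (int M - int (tail_sum \<nu> n \<nu>))
             / ((\<Prod>k=\<nu>..<\<nu>. qpoch (q ^ 6) (q ^ 6) (n k)) * qpoch (q ^ 6) (q ^ 6) (2 * n \<nu>)))
      = (\<Sum>N\<le>L. q ^ (3 * N\<^sup>2) * rqfac (q ^ 6) (int M - int N) * bailey_sum q 0 N)"
    by (rule sum.reindex_bij_witness[of _ "\<lambda>N. (\<lambda>k\<in>{\<nu>}. N)" "\<lambda>n. n \<nu>"])
       (auto simp: bailey_sum_0[OF q] tail_sum_def PiE_iff extensional_def fun_eq_iff)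
  also have "\<dots> = (\<Sum>N\<le>M. q ^ (3 * N\<^sup>2) * rqfac (q ^ 6) (int M - int N) * bailey_sum q 0 N)"
    using base by (intro sum.mono_neutral_right) (auto simp: rqfac_neg)
  finally show ?case
    by (simp add: bailey_sum_Suc[OF q])
next
  case (step a)
  define U where "U g = q ^ (3 * (\<Sum>k=Suc a..\<nu>. (tail_sum \<nu> g k)\<^sup>2)) * qpoch (- q) (q\<^sup>2) (3 * g \<nu>)
     / ((\<Prod>k=Suc a..<\<nu>. qpoch (q ^ 6) (q ^ 6) (g k)) * qpoch (q ^ 6) (q ^ 6) (2 * g \<nu>))" for g
  \<comment> \<open>The summand in terms of \<open>N\<close>, where the reciprocal of the symbol of
    length \<open>n a\<close> is written as \<open>rqfac\<close> of \<open>N\<close> minus the next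
    tail sum; it thus vanishes when \<open>N\<close> is too small.\<close>
  define H where "H g N = q ^ (3 * N\<^sup>2) * rqfac (q ^ 6) (int M - int N)
     * (U g * rqfac (q ^ 6) (int N - int (tail_sum \<nu> g (Suc a))))" for g N
  define T where "T n = q ^ (3 * (\<Sum>k=a..\<nu>. (tail_sum \<nu> n k)\<^sup>2)) * qpoch (- q) (q\<^sup>2) (3 * n \<nu>)
             * rqfac (q ^ 6) (int M - int (tail_sum \<nu> n a))
             / ((\<Prod>k=a..<\<nu>. qpoch (q ^ 6) (q ^ 6) (n k)) * qpoch (q ^ 6) (q ^ 6) (2 * n \<nu>))" for n
  have T: "T (g(a := y)) = H g (y + tail_sum \<nu> g (Suc a))" for g y
  proof -
    have head: "tail_sum \<nu> (g(a := y)) a = y + tail_sum \<nu> g (Suc a)"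
      using step.hyps by (simp add: tail_sum_rec tail_sum_upd)
    have "(\<Sum>k=a..\<nu>. (tail_sum \<nu> (g(a := y)) k)\<^sup>2)
        = (y + tail_sum \<nu> g (Suc a))\<^sup>2 + (\<Sum>k=Suc a..\<nu>. (tail_sum \<nu> g k)\<^sup>2)"
      using step.hyps by (simp add: sum.atLeast_Suc_atMost head tail_sum_upd)
    moreover have "(\<Prod>k=a..<\<nu>. qpoch (q ^ 6) (q ^ 6) ((g(a := y)) k))
        = qpoch (q ^ 6) (q ^ 6) y * (\<Prod>k=Suc a..<\<nu>. qpoch (q ^ 6) (q ^ 6) (g k))"
      using step.hyps by (simp add: prod.atLeast_Suc_lessThan)
    ultimately show ?thesis
      using step.hyps unfolding T_def H_def U_def head
      by (simp add: power_add distrib_left mult_ac)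
  qed
  \<comment> \<open>Passing from \<open>y\<close> to \<open>N = y + c\<close>, the limits can be
    changed freely: one \<open>rqfac\<close> kills \<open>N < c\<close>, the other kills
    \<open>N > M\<close>, and \<open>M \<le> L\<close> ensures that no nonzero term is lost.\<close>
  have shift: "(\<Sum>y\<le>L. H g (y + c)) = (\<Sum>N\<le>M. H g N)" if c: "c = tail_sum \<nu> g (Suc a)" for g c
  proof -
    have "(\<Sum>y\<le>L. H g (y + c)) = (\<Sum>N\<in>{c..L + c}. H g N)"
      by (rule sum.reindex_bij_witness[of _ "\<lambda>N. N - c" "\<lambda>y. y + c"]) auto
    also have "\<dots> = (\<Sum>N\<in>{..L + c}. H g N)"
      by (rule sum.mono_neutral_left) (auto simp: H_def c rqfac_neg)
    also have "\<dots> = (\<Sum>N\<le>M. H g N)"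
      using step.prems by (intro sum.mono_neutral_right) (auto simp: H_def rqfac_neg)
    finally show ?thesis .
  qed
  have ins: "{a..\<nu>} = insert a {Suc a..\<nu>}"
    using step.hyps by auto
  have "(\<Sum>n\<in>{a..\<nu>} \<rightarrow>\<^sub>E {..L}. T n)
      = (\<Sum>(y, g)\<in>{..L} \<times> ({Suc a..\<nu>} \<rightarrow>\<^sub>E {..L}). T (g(a := y)))"
    unfolding ins PiE_insert_eq
    by (subst sum.reindex) (auto intro: inj_combinator[unfolded case_prod_unfold] simp: case_prod_unfold)
  also have "\<dots> = (\<Sum>g\<in>{Suc a..\<nu>} \<rightarrow>\<^sub>E {..L}. \<Sum>y\<le>L. T (g(a := y)))"
    by (subst sum.swap) (simp only: sum.cartesian_product)
  also have "\<dots> = (\<Sum>N\<le>M. \<Sum>g\<in>{Suc a..\<nu>} \<rightarrow>\<^sub>E {..L}. H g N)"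
    unfolding T shift[OF refl] by (rule sum.swap)
  also have "\<dots> = (\<Sum>N\<le>M. q ^ (3 * N\<^sup>2) * rqfac (q ^ 6) (int M - int N) * bailey_sum q (Suc (\<nu> - Suc a)) N)"
  proof (rule sum.cong)
    fix N assume "N \<in> {..M}"
    then have "N \<le> L"
      using step.prems by simp
    then show "(\<Sum>g\<in>{Suc a..\<nu>} \<rightarrow>\<^sub>E {..L}. H g N)
        = q ^ (3 * N\<^sup>2) * rqfac (q ^ 6) (int M - int N) * bailey_sum q (Suc (\<nu> - Suc a)) N"
      unfolding H_def U_def by (subst step.IH[symmetric]) (simp_all add: sum_distrib_left)
  qed simp
  also have "\<dots> = bailey_sum q (Suc (\<nu> - a)) M"
    using step.hyps by (simp add: bailey_sum_Suc[OF q] Suc_diff_Suc)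
  finally show ?case
    unfolding T_def .
qed

theorem theorem5p2:
  fixes q :: "'a::field" and \<nu> M :: nat
  assumes "\<nu> \<ge> 1"
    and "\<And>k::nat. k > 0 \<Longrightarrow> q ^ k \<noteq> 1"
  shows "sum' (\<lambda>n. q ^ (3 * (\<Sum>k=1..\<nu>. (tail_sum \<nu> n k)\<^sup>2)) * qpoch (- q) (q ^ 2) (3 * n \<nu>)
             * rqfac (q ^ 6) (int M - int (tail_sum \<nu> n 1))
             / ((\<Prod>k=1..<\<nu>. qpoch (q ^ 6) (q ^ 6) (n k)) * qpoch (q ^ 6) (q ^ 6) (2 * n \<nu>)))
           ({1..\<nu>} \<rightarrow>\<^sub>E (UNIV :: nat set))
       = qpoch (- (q ^ 3)) (q ^ 6) M / qpoch (q ^ 6) (q ^ 6) (2 * M)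
         * (\<Sum>j = - int M..int M.
              q powi (3 * (int \<nu> + 1) * j\<^sup>2 + 2 * j) * qbinom (q ^ 6) (2 * int M) (int M + j))"
    (is "sum' ?f ?A = ?rhs")
proof -
  have q: "\<forall>k>0. q ^ k \<noteq> 1"
    using assms(2) by blast
  \<comment> \<open>An entry exceeding \<open>M\<close> forces the first tail sum above
    \<open>M\<close>, where \<open>rqfac\<close> is zero; so the finite box with
    \<open>L = M\<close> carries the whole sum.\<close>
  have "sum' ?f ?A = sum' ?f ({1..\<nu>} \<rightarrow>\<^sub>E {..M})"
  proof (rule sum.mono_neutral_right')
    show "\<forall>n \<in> ?A - ({1..\<nu>} \<rightarrow>\<^sub>E {..M}). ?f n = 0"
    proof
      fix n assume n: "n \<in> ?A - ({1..\<nu>} \<rightarrow>\<^sub>E {..M})"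
      then obtain i where i: "i \<in> {1..\<nu>}" "n i > M"
        by (auto simp: PiE_iff not_le)
      have "n i \<le> tail_sum \<nu> n 1"
        unfolding tail_sum_def using i(1) by (intro member_le_sum) auto
      with i(2) show "?f n = 0"
        by (simp add: rqfac_neg)
    qed
  qed (auto simp: PiE_iff)
  also have "\<dots> = sum ?f ({1..\<nu>} \<rightarrow>\<^sub>E {..M})"
    by (intro sum.eq_sum finite_PiE) auto
  also have "\<dots> = bailey_sum q \<nu> M"
    using bailey_multisum[OF q assms(1) order_refl] assms(1) by simp
  also have "\<dots> = ?rhs"
    by (rule bailey_sum_eq_qbinom[OF q])
  finally show ?thesis .
qed

end
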